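(* Let $A\colon L^1(\Omega)\to\mathbb R$ be a bounded linear functional, $\alpha>0$ a constant, $\rho\in\operatorname{int}L^\infty_{[0,1]}(\Omega)$ fixed, and $\mathcal C$ any non-empty, closed, convex subset of $L^1_{[0,1]}(\Omega)$ (closed in $L^1(\Omega)$). Then the problem $$\min_{q\in\mathcal C}\big\{J(q):=\langle A,q\rangle+\alpha^{-1}D_\varphi(q,\rho)\big\}$$ has a unique solution.
   Context: $\Omega\subset\mathbb R^d$ ($d=2$ or $3$) is a bounded open domain with Lipschitz boundary. $L^1_{[0,1]}(\Omega)=\{\rho\in L^1(\Omega):0\le\rho\le1\text{ a.e. in }\Omega\}$, and $\operatorname{int}L^\infty_{[0,1]}(\Omega)=\{\rho\in L^\infty(\Omega):\operatorname{ess\,inf}\rho>0,\ \operatorname{ess\,sup}\rho<1\}$. $\varphi$ is the Fermi--Dirac entropy $\varphi(\rho)=\int_\Omega\rho\ln\rho+(1-\rho)\ln(1-\rho)\,dx$ (with $0\ln0=0$) for $0\le\rho\le1$ a.e., $+\infty$ otherwise, and its Bregman divergence is $D_\varphi(q,\rho)=\int_\Omega q\ln\frac{q}{\rho}+(1-q)\ln\frac{1-q}{1-\rho}\,dx$ for $q\in L^1_{[0,1]}(\Omega)$ and $\rho\in\operatorname{int}L^\infty_{[0,1]}(\Omega)$. *)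

theory Defs
  imports "HOL-Analysis.Analysis" "HOL-Probability.Essential_Supremum"
begin

text \<open>
  Elements of \<open>L\<^sup>1(\<Omega>)\<close> and \<open>L\<^sup>\<infinity>(\<Omega>)\<close> are represented by functions;
  two functions stand for the same element iff they agree almost everywhere in \<open>\<Omega>\<close>.
  Values outside \<open>\<Omega>\<close> are irrelevant.
\<close>

text \<open>
  Near each boundary point, and with respect to a suitable unit vector \<open>\<nu>\<close> as last coordinate
  axis, the set lies strictly above the graph of a Lipschitz function of the remaining
  coordinates. The latter are parametrised by the hyperplane orthogonal to \<open>\<nu>\<close>,
  and \<open>x - (x \<bullet> \<nu>) *\<^sub>R \<nu>\<close> is the projection of \<open>x\<close> onto it.
\<close>

definition lipschitz_boundary :: "'a::euclidean_space set \<Rightarrow> bool" where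
  "lipschitz_boundary \<Omega> \<longleftrightarrow>
    (\<forall>p\<in>frontier \<Omega>. \<exists>r>0. \<exists>\<nu> \<gamma> L. norm \<nu> = 1 \<and>
       L-lipschitz_on {z. z \<bullet> \<nu> = 0} (\<gamma> :: 'a \<Rightarrow> real) \<and>
       \<Omega> \<inter> ball p r = {x \<in> ball p r. \<gamma> (x - (x \<bullet> \<nu>) *\<^sub>R \<nu>) < x \<bullet> \<nu>})"

definition L1 :: "'a::euclidean_space set \<Rightarrow> ('a \<Rightarrow> real) set" where
  "L1 \<Omega> = {f. integrable (lebesgue_on \<Omega>) f}"

definition L1_norm :: "'a::euclidean_space set \<Rightarrow> ('a \<Rightarrow> real) \<Rightarrow> real" where
  "L1_norm \<Omega> f = (LINT x|lebesgue_on \<Omega>. \<bar>f x\<bar>)"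

definition L1_01 :: "'a::euclidean_space set \<Rightarrow> ('a \<Rightarrow> real) set" where
  "L1_01 \<Omega> = {f \<in> L1 \<Omega>. AE x in lebesgue_on \<Omega>. 0 \<le> f x \<and> f x \<le> 1}"

definition essinf :: "'a measure \<Rightarrow> ('a \<Rightarrow> ereal) \<Rightarrow> ereal" where
  "essinf M f = Sup {c. AE x in M. c \<le> f x}"

definition Linfty :: "'a::euclidean_space set \<Rightarrow> ('a \<Rightarrow> real) set" where
  "Linfty \<Omega> = {f \<in> borel_measurable (lebesgue_on \<Omega>).
     esssup (lebesgue_on \<Omega>) (\<lambda>x. ereal \<bar>f x\<bar>) < \<infinity>}"

definition int_Linfty_01 :: "'a::euclidean_space set \<Rightarrow> ('a \<Rightarrow> real) set" where
  "int_Linfty_01 \<Omega> = {\<rho> \<in> Linfty \<Omega>.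
     essinf (lebesgue_on \<Omega>) (\<lambda>x. ereal (\<rho> x)) > 0 \<and>
     esssup (lebesgue_on \<Omega>) (\<lambda>x. ereal (\<rho> x)) < 1}"

text \<open>
  The bound makes such a functional independent of the chosen representative:
  by linearity, it takes the same value on functions that agree almost everywhere.
\<close>

definition bounded_linear_L1 ::
    "'a::euclidean_space set \<Rightarrow> (('a \<Rightarrow> real) \<Rightarrow> real) \<Rightarrow> bool" where
  "bounded_linear_L1 \<Omega> A \<longleftrightarrow>
    (\<forall>f\<in>L1 \<Omega>. \<forall>g\<in>L1 \<Omega>. A (\<lambda>x. f x + g x) = A f + A g) \<and>
    (\<forall>c. \<forall>f\<in>L1 \<Omega>. A (\<lambda>x. c * f x) = c * A f) \<and>
    (\<exists>K. \<forall>f\<in>L1 \<Omega>. \<bar>A f\<bar> \<le> K * L1_norm \<Omega> f)"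

text \<open>
  The set contains all its adherent points in the \<open>L\<^sup>1\<close> seminorm. In particular it contains,
  along with a function, every other representative of the same element of \<open>L\<^sup>1(\<Omega>)\<close>.
\<close>

definition closed_L1 :: "'a::euclidean_space set \<Rightarrow> ('a \<Rightarrow> real) set \<Rightarrow> bool" where
  "closed_L1 \<Omega> C \<longleftrightarrow> C \<subseteq> L1 \<Omega> \<and>
    (\<forall>f\<in>L1 \<Omega>. (\<forall>e>0. \<exists>g\<in>C. L1_norm \<Omega> (\<lambda>x. f x - g x) < e) \<longrightarrow> f \<in> C)"

definition convex_fun_set :: "('a \<Rightarrow> real) set \<Rightarrow> bool" where
  "convex_fun_set C \<longleftrightarrow>
    (\<forall>f\<in>C. \<forall>g\<in>C. \<forall>u\<ge>0. \<forall>v\<ge>0. u + v = 1 \<longrightarrow> (\<lambda>x. u * f x + v * g x) \<in> C)"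

text \<open>
  Since \<open>0 * ln 0 = 0\<close>, the convention \<open>0 ln 0 = 0\<close> needs no case distinction. For \<open>q\<close> in
  \<open>L1_01 \<Omega>\<close> and \<open>\<rho>\<close> in \<open>int_Linfty_01 \<Omega>\<close>, the integrand is essentially bounded, so on a bounded
  \<open>\<Omega>\<close> the integral is never the default value for non-integrable functions.
\<close>

definition bregman_FD ::
    "'a::euclidean_space set \<Rightarrow> ('a \<Rightarrow> real) \<Rightarrow> ('a \<Rightarrow> real) \<Rightarrow> real" where
  "bregman_FD \<Omega> q \<rho> =
    (LINT x|lebesgue_on \<Omega>. q x * ln (q x / \<rho> x) + (1 - q x) * ln ((1 - q x) / (1 - \<rho> x)))"

definition J_FD ::
    "'a::euclidean_space set \<Rightarrow> (('a \<Rightarrow> real) \<Rightarrow> real) \<Rightarrow> real \<Rightarrow> ('a \<Rightarrow> real) \<Rightarrow> ('a \<Rightarrow> real) \<Rightarrow> real"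
  where "J_FD \<Omega> A \<alpha> \<rho> q = A q + inverse \<alpha> * bregman_FD \<Omega> q \<rho>"

end

theory Submission
  imports Defs "HOL-Real_Asymp.Real_Asymp"
begin

text \<open>
  The integrand of the divergence is strongly convex in \<open>q\<close>, so the parallelogram argument applies:
  near-minimisers are close to each other in \<open>L\<^sup>2\<close>, hence in \<open>L\<^sup>1\<close>. A minimising sequence whose
  values approach the infimum geometrically has summable \<open>L\<^sup>1\<close> increments and therefore converges
  almost everywhere. All functions involved are essentially bounded and the domain has finite
  measure, so dominated convergence gives convergence in \<open>L\<^sup>1\<close> and of the functional. The limit
  is a minimiser, and the parallelogram argument yields uniqueness. No weak compactness is needed.
\<close>

section \<open>The Bernoulli relative entropy\<close>

definition bernoulli_kl :: "real \<Rightarrow> real \<Rightarrow> real" where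
  "bernoulli_kl q r = q * ln (q / r) + (1 - q) * ln ((1 - q) / (1 - r))"

text \<open>\<open>s * ln (s / m) - (s - m)\<close> is the remainder of the tangent line to
  \<open>s * ln s\<close> at \<open>m\<close>. It dominates a squared difference of square roots,
  which on the unit interval controls \<open>(s - m)^2\<close>.\<close>

lemma mult_ln_div_ge:
  fixes s m :: real
  assumes "0 \<le> s" "s \<le> 1" "0 < m" "m \<le> 1"
  shows "s - m + (s - m)\<^sup>2 / 4 \<le> s * ln (s / m)"
proof -
  \<comment> \<open>From \<open>ln y \<le> y - 1\<close> at \<open>y = sqrt (m / s)\<close>, the right side exceeds \<open>s - m\<close> by at least
    \<open>(sqrt s - sqrt m)\<^sup>2\<close>.\<close>
  have root: "s - m + (sqrt s - sqrt m)\<^sup>2 \<le> s * ln (s / m)"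
  proof (cases "s = 0")
    case False
    with assms have s: "0 < s" by simp
    have "ln (sqrt (m / s)) \<le> sqrt (m / s) - 1"
      using s assms by (intro ln_le_minus_one) simp
    hence "ln m - ln s \<le> 2 * (sqrt (m / s) - 1)"
      using s assms by (simp add: ln_sqrt ln_div)
    hence "s * (ln m - ln s) \<le> s * (2 * (sqrt (m / s) - 1))"
      using s by (intro mult_left_mono) auto
    moreover have "s * sqrt (m / s) = sqrt s * sqrt m"
    proof -
      have "s * sqrt (m / s) = (sqrt s * sqrt s) * (sqrt m / sqrt s)"
        using s by (simp add: real_sqrt_divide)
      also have "\<dots> = sqrt s * sqrt m" using s by (simp del: real_sqrt_mult_self)
      finally show ?thesis .
    qed
    moreover have "(sqrt s - sqrt m)\<^sup>2 = s + m - 2 * (sqrt s * sqrt m)"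
      using s assms by (simp add: power2_diff)
    ultimately show ?thesis
      using s assms by (simp add: ln_div algebra_simps)
  qed (use assms in simp)
  \<comment> \<open>Difference of squares: as \<open>sqrt s + sqrt m\<close> is at most 2, passing
    back from the square roots costs the factor 4.\<close>
  have "s - m = (sqrt s - sqrt m) * (sqrt s + sqrt m)"
    using assms by (simp add: algebra_simps)
  hence "(s - m)\<^sup>2 = (sqrt s - sqrt m)\<^sup>2 * (sqrt s + sqrt m)\<^sup>2"
    by (simp add: power_mult_distrib)
  also have "(sqrt s + sqrt m)\<^sup>2 \<le> 2\<^sup>2"
    using assms add_mono[of "sqrt s" 1 "sqrt m" 1] by (intro power_mono) auto
  hence "(sqrt s - sqrt m)\<^sup>2 * (sqrt s + sqrt m)\<^sup>2 \<le> (sqrt s - sqrt m)\<^sup>2 * 4"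
    by (intro mult_left_mono) auto
  finally show ?thesis using root by simp
qed

text \<open>Add the tangent inequality at the midpoint for \<open>s\<close> and for
  \<open>t\<close>: the linear terms cancel, and each remainder is
  \<open>(s - t)^2 / 16\<close>.\<close>

lemma mult_ln_midpoint:
  fixes s t :: real
  assumes "0 \<le> s" "s \<le> 1" "0 \<le> t" "t \<le> 1"
  shows "2 * ((s + t) / 2 * ln ((s + t) / 2)) + (s - t)\<^sup>2 / 8 \<le> s * ln s + t * ln t"
proof (cases "s = 0 \<and> t = 0")
  case False
  define m where "m = (s + t) / 2"
  have m: "0 < m" "m \<le> 1" using False assms by (auto simp: m_def)
  have split: "x * ln (x / m) = x * ln x - x * ln m" if "0 \<le> x" for x
    using that m by (cases "x = 0") (auto simp: ln_div algebra_simps)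
  have "(s - m)\<^sup>2 = (s - t)\<^sup>2 / 4" "(t - m)\<^sup>2 = (s - t)\<^sup>2 / 4" "s + t = 2 * m"
    by (auto simp: m_def power2_eq_square field_simps)
  moreover have "s * ln m + t * ln m = 2 * (m * ln m)"
    by (simp add: m_def field_simps)
  ultimately show ?thesis
    using mult_ln_div_ge[of s m] mult_ln_div_ge[of t m] m assms split
    unfolding m_def[symmetric] by simp
qed simp

lemma bernoulli_kl_eq:
  assumes "0 \<le> q" "q \<le> 1" "0 < r" "r < 1"
  shows "bernoulli_kl q r =
    q * ln q + (1 - q) * ln (1 - q) - q * ln r - (1 - q) * ln (1 - r)"
proof -
  have "x * ln (x / y) = x * ln x - x * ln y" if "0 \<le> x" "0 < y" for x y :: real
    using that by (cases "x = 0") (auto simp: ln_div algebra_simps)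
  thus ?thesis using assms by (simp add: bernoulli_kl_def)
qed

text \<open>The terms in \<open>ln r\<close> and \<open>ln (1 - r)\<close> are affine in the first
  argument and cancel. The pairs \<open>s\<close>, \<open>t\<close> and \<open>1 - s\<close>,
  \<open>1 - t\<close> each contribute \<open>(s - t)^2 / 8\<close>; halving the sum leaves one
  eighth.\<close>

lemma bernoulli_kl_midpoint:
  assumes "0 \<le> s" "s \<le> 1" "0 \<le> t" "t \<le> 1" "0 < r" "r < 1"
  shows "bernoulli_kl ((s + t) / 2) r \<le>
    (bernoulli_kl s r + bernoulli_kl t r) / 2 - (s - t)\<^sup>2 / 8"
proof -
  have "(1 - s + (1 - t)) / 2 = 1 - (s + t) / 2" "(1 - s - (1 - t))\<^sup>2 = (s - t)\<^sup>2"
    by (simp_all add: field_simps power2_eq_square)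
  thus ?thesis
    using mult_ln_midpoint[of s t] mult_ln_midpoint[of "1 - s" "1 - t"] assms
    by (simp add: bernoulli_kl_eq field_simps)
qed

text \<open>The first-order terms \<open>q - r\<close> and \<open>(1 - q) - (1 - r)\<close> of the
  tangent inequality cancel, leaving squares.\<close>

lemma bernoulli_kl_nonneg:
  assumes "0 \<le> q" "q \<le> 1" "0 < r" "r < 1"
  shows "0 \<le> bernoulli_kl q r"
proof -
  have "0 \<le> (q - r)\<^sup>2" by simp
  thus ?thesis
    using mult_ln_div_ge[of q r] mult_ln_div_ge[of "1 - q" "1 - r"] assms
    unfolding bernoulli_kl_def by (smt (verit) divide_nonneg_pos zero_le_power2)
qed

text \<open>Numerators are at most 1 and denominators at least \<open>e\<close>, so each logarithm
  with nonzero weight is at most \<open>- ln e\<close>; the weights sum to 1. Being independent of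
  \<open>q\<close>, the bound can serve as a dominating constant.\<close>

lemma bernoulli_kl_le:
  assumes "0 \<le> q" "q \<le> 1" "0 < e" "e \<le> r" "r \<le> 1 - e"
  shows "bernoulli_kl q r \<le> - ln e"
proof -
  have le: "x * ln (x / y) \<le> x * (- ln e)" if "0 \<le> x" "x \<le> 1" "e \<le> y" for x y
  proof (cases "x = 0")
    case False
    with that have "ln x \<le> 0" "ln e \<le> ln y" using assms by auto
    moreover have "ln (x / y) = ln x - ln y"
      using that False assms by (simp add: ln_div)
    ultimately have "ln (x / y) \<le> - ln e" by linarith
    thus ?thesis using that by (intro mult_left_mono) auto
  qed simp
  have "bernoulli_kl q r \<le> q * (- ln e) + (1 - q) * (- ln e)"
    unfolding bernoulli_kl_def using assms by (intro add_mono le) auto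
  thus ?thesis by (simp add: algebra_simps)
qed

section \<open>Continuity of the integrand up to the endpoints\<close>

lemma continuous_on_mult_ln: "continuous_on {0..} (\<lambda>x::real. x * ln x)"
  unfolding continuous_on_def
proof
  fix x :: real assume "x \<in> {0..}"
  show "((\<lambda>x. x * ln x) \<longlongrightarrow> x * ln x) (at x within {0..})"
  proof (cases "x = 0")
    case True
    have "((\<lambda>x::real. x * ln x) \<longlongrightarrow> 0) (at_right 0)" by real_asymp
    thus ?thesis using True by (simp add: at_within_Ici_at_right)
  qed (auto intro!: tendsto_eq_intros)
qed

text \<open>The endpoints matter: functions in \<open>L1_01 \<Omega>\<close> may equal 0 or 1 on
  sets of positive measure.\<close>

lemma continuous_on_bernoulli_kl:
  assumes "0 < r" "r < 1"
  shows "continuous_on {0..1} (\<lambda>q. bernoulli_kl q r)"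
proof -
  have "continuous_on {0..1} (\<lambda>q::real. q * ln q)"
    by (rule continuous_on_subset[OF continuous_on_mult_ln]) auto
  moreover have "continuous_on {0..1} (\<lambda>q::real. (1 - q) * ln (1 - q))"
    by (rule continuous_on_compose2[OF continuous_on_mult_ln, of "{0..1}" "\<lambda>q. 1 - q"])
      (auto intro: continuous_on_diff continuous_on_const continuous_on_id)
  ultimately have "continuous_on {0..1}
      (\<lambda>q. q * ln q + (1 - q) * ln (1 - q) - q * ln r - (1 - q) * ln (1 - r))"
    by (intro continuous_on_add continuous_on_diff continuous_on_mult_right
        continuous_on_const continuous_on_id)
  thus ?thesis
    by (rule continuous_on_eq) (use assms in \<open>auto simp: bernoulli_kl_eq\<close>)
qed

section \<open>Sequences in \<open>L\<^sup>1\<close> of a finite measure\<close>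

text \<open>By monotone convergence the sum of the absolute increments has a finite integral, hence
  is finite almost everywhere; there the sequence converges by telescoping.\<close>

lemma AE_convergent_if_summable_increments:
  fixes f :: "nat \<Rightarrow> 'a \<Rightarrow> real"
  assumes int: "\<And>n. integrable M (f n)"
    and sum: "summable (\<lambda>n. LINT x|M. \<bar>f n x - f (Suc n) x\<bar>)"
  shows "AE x in M. convergent (\<lambda>n. f n x)"
proof -
  define d where "d n x = \<bar>f n x - f (Suc n) x\<bar>" for n x
  have d: "integrable M (d n)" for n
    unfolding d_def by (intro integrable_abs Bochner_Integration.integrable_diff int)
  have d_nonneg: "0 \<le> d n x" for n x by (simp add: d_def)
  note [measurable] = borel_measurable_integrable[OF d]
  have "(\<integral>\<^sup>+x. (\<Sum>n. ennreal (d n x)) \<partial>M) = (\<Sum>n. \<integral>\<^sup>+x. ennreal (d n x) \<partial>M)"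
    by (rule nn_integral_suminf) measurable
  also have "\<dots> = (\<Sum>n. ennreal (LINT x|M. d n x))"
    by (simp only: nn_integral_eq_integral[OF d AE_I2[OF d_nonneg]])
  also have "\<dots> \<noteq> \<infinity>"
    unfolding infinity_ennreal_def d_def by (rule ennreal_suminf_neq_top[OF sum]) simp
  finally have "AE x in M. (\<Sum>n. ennreal (d n x)) \<noteq> \<infinity>"
    by (intro nn_integral_noteq_infinite) measurable
  thus ?thesis
  proof eventually_elim
    case (elim x)
    hence "summable (\<lambda>n. d n x)"
      by (intro summable_suminf_not_top) (auto simp: d_def)
    hence "summable (\<lambda>n. f n x - f (Suc n) x)"
      unfolding d_def by (rule summable_rabs_cancel)
    hence "summable (\<lambda>n. - (f n x - f (Suc n) x))" by (rule summable_minus)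
    hence "convergent (\<lambda>n. \<Sum>i<n. f (Suc i) x - f i x)"
      by (simp add: summable_iff_convergent)
    hence "convergent (\<lambda>n. f n x - f 0 x)"
      by (simp add: sum_lessThan_telescope[where f = "\<lambda>n. f n x"])
    thus ?case using convergent_add[OF _ convergent_const[of "f 0 x"]] by fastforce
  qed
qed

text \<open>Young's inequality with weight \<open>\<eta>\<close> plays the role of Cauchy-Schwarz
  and gives a bound linear in \<open>\<eta>\<close>.\<close>

lemma (in finite_measure) integral_abs_le_of_integral_square:
  fixes d :: "'a \<Rightarrow> real"
  assumes "integrable M d" "integrable M (\<lambda>x. (d x)\<^sup>2)" "0 < \<eta>"
    and le: "(LINT x|M. (d x)\<^sup>2) \<le> \<eta>\<^sup>2"
  shows "(LINT x|M. \<bar>d x\<bar>) \<le> \<eta> * (1 + measure M (space M)) / 2"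
proof -
  have "\<bar>y\<bar> \<le> (y\<^sup>2 / \<eta> + \<eta>) / 2" for y
  proof -
    have "0 \<le> (\<bar>y\<bar> - \<eta>)\<^sup>2" by simp
    hence "2 * \<eta> * \<bar>y\<bar> \<le> y\<^sup>2 + \<eta>\<^sup>2" by (simp add: power2_diff algebra_simps)
    thus ?thesis using \<open>0 < \<eta>\<close> by (simp add: field_simps power2_eq_square)
  qed
  hence "(LINT x|M. \<bar>d x\<bar>) \<le> (LINT x|M. ((d x)\<^sup>2 / \<eta> + \<eta>) / 2)"
    using assms by (intro integral_mono) auto
  also have "\<dots> = ((LINT x|M. (d x)\<^sup>2) / \<eta> + \<eta> * measure M (space M)) / 2"
    using assms by simp
  also have "(LINT x|M. (d x)\<^sup>2) / \<eta> \<le> \<eta>"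
    using le \<open>0 < \<eta>\<close> by (simp add: field_simps power2_eq_square)
  finally show ?thesis by (simp add: algebra_simps)
qed

section \<open>The functional\<close>

text \<open>The strict essential bounds leave room for real thresholds \<open>a\<close> and
  \<open>b\<close>; \<open>e\<close> is the smaller of the margins \<open>a\<close> and
  \<open>1 - b\<close>.\<close>

lemma int_Linfty_01_bounds:
  assumes "\<rho> \<in> int_Linfty_01 \<Omega>"
  obtains e where "0 < e" "AE x in lebesgue_on \<Omega>. e \<le> \<rho> x \<and> \<rho> x \<le> 1 - e"
proof -
  have lo: "0 < essinf (lebesgue_on \<Omega>) (\<lambda>x. ereal (\<rho> x))"
    and hi: "esssup (lebesgue_on \<Omega>) (\<lambda>x. ereal (\<rho> x)) < 1"
    using assms by (auto simp: int_Linfty_01_def)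
  obtain c where c: "0 < c" "AE x in lebesgue_on \<Omega>. c \<le> ereal (\<rho> x)"
    using lo unfolding essinf_def less_Sup_iff by auto
  obtain a :: real where a: "0 < ereal a" "ereal a < c"
    using ereal_dense2[OF c(1)] by auto
  obtain b :: real where b: "esssup (lebesgue_on \<Omega>) (\<lambda>x. ereal (\<rho> x)) < ereal b" "ereal b < 1"
    using ereal_dense2[OF hi] by auto
  have "AE x in lebesgue_on \<Omega>. min a (1 - b) \<le> \<rho> x \<and> \<rho> x \<le> 1 - min a (1 - b)"
    using c(2) esssup_AE[of "\<lambda>x. ereal (\<rho> x)" "lebesgue_on \<Omega>"]
  proof eventually_elim
    case (elim x)
    have "ereal a < ereal (\<rho> x)" using a(2) elim(1) by (rule less_le_trans)
    moreover have "ereal (\<rho> x) < ereal b" using elim(2) b(1) by (rule le_less_trans)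
    ultimately show ?case by auto
  qed
  moreover have "0 < min a (1 - b)" using a b by simp
  ultimately show thesis using that by blast
qed

text \<open>Holds the data in the form used by the estimates: a finite measure, and a margin
  \<open>e\<close> keeping \<open>\<rho>\<close> uniformly away from 0 and 1.\<close>

locale fd_problem =
  fixes \<Omega> :: "'a::euclidean_space set"
    and A :: "('a \<Rightarrow> real) \<Rightarrow> real"
    and \<alpha> e :: real
    and \<rho> :: "'a \<Rightarrow> real"
  assumes finite_measure_domain: "finite_measure (lebesgue_on \<Omega>)"
    and A: "bounded_linear_L1 \<Omega> A"
    and \<alpha>: "0 < \<alpha>"
    and \<rho>_meas [measurable]: "\<rho> \<in> borel_measurable (lebesgue_on \<Omega>)"
    and e: "0 < e"
    and \<rho>_bounds: "AE x in lebesgue_on \<Omega>. e \<le> \<rho> x \<and> \<rho> x \<le> 1 - e"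
begin

abbreviation "M \<equiv> lebesgue_on \<Omega>"
abbreviation "J \<equiv> J_FD \<Omega> A \<alpha> \<rho>"

sublocale finite_measure M by (rule finite_measure_domain)

section \<open>Measurability and integrability of the integrand\<close>

lemma bregman_FD_eq: "bregman_FD \<Omega> q \<rho> = (LINT x|M. bernoulli_kl (q x) (\<rho> x))"
  by (simp add: bregman_FD_def bernoulli_kl_def)

lemma L1_01_integrable: "f \<in> L1_01 \<Omega> \<Longrightarrow> integrable M f"
  by (simp add: L1_01_def L1_def)

lemma L1_01_measurable [measurable_dest]: "f \<in> L1_01 \<Omega> \<Longrightarrow> f \<in> borel_measurable M"
  using L1_01_integrable by blast

lemma L1_01_bounds: "f \<in> L1_01 \<Omega> \<Longrightarrow> AE x in M. 0 \<le> f x \<and> f x \<le> 1"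
  by (simp add: L1_01_def)

lemma bernoulli_kl_measurable [measurable (raw)]:
  assumes [measurable]: "f \<in> borel_measurable M"
  shows "(\<lambda>x. bernoulli_kl (f x) (\<rho> x)) \<in> borel_measurable M"
  unfolding bernoulli_kl_def by measurable

text \<open>The constant is the same for every admissible function, so it yields both integrability
  and domination in the limit passage.\<close>

lemma bernoulli_kl_AE_bound:
  assumes "f \<in> L1_01 \<Omega>"
  shows "AE x in M. norm (bernoulli_kl (f x) (\<rho> x)) \<le> - ln e"
  using L1_01_bounds[OF assms] \<rho>_bounds
proof eventually_elim
  case (elim x)
  thus ?case
    using bernoulli_kl_nonneg[of "f x" "\<rho> x"] bernoulli_kl_le[of "f x" e "\<rho> x"] e by simp
qed

lemma bernoulli_kl_integrable:
  assumes "f \<in> L1_01 \<Omega>"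
  shows "integrable M (\<lambda>x. bernoulli_kl (f x) (\<rho> x))"
  by (rule integrable_const_bound[OF bernoulli_kl_AE_bound[OF assms]]) (use assms in measurable)

lemma square_diff_integrable:
  assumes "f \<in> L1_01 \<Omega>" "g \<in> L1_01 \<Omega>"
  shows "integrable M (\<lambda>x. (f x - g x)\<^sup>2)"
proof (rule integrable_const_bound)
  show "AE x in M. norm ((f x - g x)\<^sup>2) \<le> 1"
    using L1_01_bounds[OF assms(1)] L1_01_bounds[OF assms(2)]
    by eventually_elim (auto simp: abs_square_le_1 abs_le_iff)
qed (use assms in measurable)

section \<open>Midpoint inequality and lower bound\<close>

lemma A_add: "f \<in> L1 \<Omega> \<Longrightarrow> g \<in> L1 \<Omega> \<Longrightarrow> A (\<lambda>x. f x + g x) = A f + A g"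
  using A unfolding bounded_linear_L1_def by blast

lemma A_scale: "f \<in> L1 \<Omega> \<Longrightarrow> A (\<lambda>x. c * f x) = c * A f"
  using A unfolding bounded_linear_L1_def by blast

text \<open>Integrating the pointwise midpoint inequality gives the quadratic gain; the linear part
  contributes exactly the average and leaves the gain intact.\<close>

lemma J_midpoint:
  assumes f: "f \<in> L1_01 \<Omega>" and g: "g \<in> L1_01 \<Omega>"
    and h: "(\<lambda>x. 1/2 * f x + 1/2 * g x) \<in> L1_01 \<Omega>"
  shows "J (\<lambda>x. 1/2 * f x + 1/2 * g x) \<le>
    (J f + J g) / 2 - inverse \<alpha> * (LINT x|M. (f x - g x)\<^sup>2) / 8"
proof -
  let ?h = "\<lambda>x. 1/2 * f x + 1/2 * g x"
  note [simp] = bernoulli_kl_integrable[OF f] bernoulli_kl_integrable[OF g]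
    square_diff_integrable[OF f g]
  have "bregman_FD \<Omega> ?h \<rho> \<le> (LINT x|M. (bernoulli_kl (f x) (\<rho> x) + bernoulli_kl (g x) (\<rho> x)) / 2
      - (f x - g x)\<^sup>2 / 8)"
    unfolding bregman_FD_eq
  proof (rule integral_mono_AE)
    show "AE x in M. bernoulli_kl (?h x) (\<rho> x) \<le>
        (bernoulli_kl (f x) (\<rho> x) + bernoulli_kl (g x) (\<rho> x)) / 2 - (f x - g x)\<^sup>2 / 8"
      using L1_01_bounds[OF f] L1_01_bounds[OF g] \<rho>_bounds
    proof eventually_elim
      case (elim x)
      thus ?case using bernoulli_kl_midpoint[of "f x" "g x" "\<rho> x"] e
        by (simp add: add_divide_distrib)
    qed
  qed (use bernoulli_kl_integrable[OF h] in simp_all)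
  also have "\<dots> = (bregman_FD \<Omega> f \<rho> + bregman_FD \<Omega> g \<rho>) / 2 - (LINT x|M. (f x - g x)\<^sup>2) / 8"
    by (simp add: bregman_FD_eq)
  finally have "inverse \<alpha> * bregman_FD \<Omega> ?h \<rho> \<le> inverse \<alpha> *
      ((bregman_FD \<Omega> f \<rho> + bregman_FD \<Omega> g \<rho>) / 2 - (LINT x|M. (f x - g x)\<^sup>2) / 8)"
    using \<alpha> by (intro mult_left_mono) auto
  moreover have "A ?h = (A f + A g) / 2"
  proof -
    have int: "f \<in> L1 \<Omega>" "g \<in> L1 \<Omega>" "(\<lambda>x. 1/2 * f x) \<in> L1 \<Omega>" "(\<lambda>x. 1/2 * g x) \<in> L1 \<Omega>"
      using L1_01_integrable[OF f] L1_01_integrable[OF g] by (auto simp: L1_def)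
    show ?thesis
      using A_add[OF int(3,4)] A_scale[OF int(1), of "1/2"] A_scale[OF int(2), of "1/2"] by simp
  qed
  ultimately show ?thesis by (simp add: J_FD_def algebra_simps add_divide_distrib)
qed

text \<open>The divergence is nonnegative, and \<open>A\<close> is controlled because admissible
  functions have \<open>L1_norm\<close> at most the measure of the domain.\<close>

lemma J_bounded_below: "\<exists>B. \<forall>f\<in>L1_01 \<Omega>. B \<le> J f"
proof -
  obtain K where K: "\<And>f. f \<in> L1 \<Omega> \<Longrightarrow> \<bar>A f\<bar> \<le> K * L1_norm \<Omega> f"
    using A unfolding bounded_linear_L1_def by blast
  \<comment> \<open>The bounding constant \<open>K\<close> carries no sign, hence its absolute
    value.\<close>
  have "- (\<bar>K\<bar> * measure M (space M)) \<le> J f" if f: "f \<in> L1_01 \<Omega>" for f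
  proof -
    have "L1_norm \<Omega> f \<le> (LINT x|M. 1)"
      unfolding L1_norm_def
      using L1_01_integrable[OF f] L1_01_bounds[OF f] by (intro integral_mono_AE) auto
    hence "L1_norm \<Omega> f \<le> measure M (space M)" by simp
    moreover have "0 \<le> L1_norm \<Omega> f" by (simp add: L1_norm_def)
    ultimately have "K * L1_norm \<Omega> f \<le> \<bar>K\<bar> * measure M (space M)"
      by (intro mult_mono) auto
    moreover have "f \<in> L1 \<Omega>" using f by (simp add: L1_01_def)
    ultimately have "- (\<bar>K\<bar> * measure M (space M)) \<le> A f" using K[of f] by linarith
    moreover have "0 \<le> bregman_FD \<Omega> f \<rho>"
      unfolding bregman_FD_eq
    proof (rule integral_nonneg_AE)
      show "AE x in M. 0 \<le> bernoulli_kl (f x) (\<rho> x)"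
        using L1_01_bounds[OF f] \<rho>_bounds
        by eventually_elim (use e in \<open>auto intro!: bernoulli_kl_nonneg\<close>)
    qed
    ultimately show ?thesis using \<alpha> by (simp add: J_FD_def add_increasing2)
  qed
  thus ?thesis by blast
qed

text \<open>Almost everywhere convergence suffices: the integrands are dominated by the constants 1
  and \<open>- ln e\<close>, which are integrable for a finite measure.\<close>

lemma AE_limit:
  assumes f: "\<And>n. f n \<in> L1_01 \<Omega>" and conv: "AE x in M. convergent (\<lambda>n. f n x)"
  obtains q where "q \<in> L1_01 \<Omega>" "(\<lambda>n. L1_norm \<Omega> (\<lambda>x. q x - f n x)) \<longlonglongrightarrow> 0"
    "(\<lambda>n. J (f n)) \<longlonglongrightarrow> J q"
proof -
  \<comment> \<open>Where the sequence diverges the value of \<open>lim\<close> is arbitrary, but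
    this happens only on a null set.\<close>
  define q where "q x = lim (\<lambda>n. f n x)" for x
  note [measurable] = L1_01_measurable[OF f]
  have q_meas [measurable]: "q \<in> borel_measurable M"
    unfolding q_def by measurable
  have all_bounds: "AE x in M. \<forall>n. 0 \<le> f n x \<and> f n x \<le> 1"
    using L1_01_bounds[OF f] by (simp add: AE_all_countable)
  have lim: "AE x in M. (\<lambda>n. f n x) \<longlonglongrightarrow> q x"
    using conv by eventually_elim (simp add: q_def convergent_LIMSEQ_iff)
  have q_bounds: "AE x in M. 0 \<le> q x \<and> q x \<le> 1"
    using all_bounds lim
    by eventually_elim (auto intro: LIMSEQ_le_const LIMSEQ_le_const2)
  have "integrable M q"
    by (rule integrable_const_bound[where B = 1]) (use q_bounds in \<open>auto elim!: AE_mp\<close>)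
  with q_bounds have q: "q \<in> L1_01 \<Omega>" by (simp add: L1_01_def L1_def)
  have "(\<lambda>n. LINT x|M. \<bar>q x - f n x\<bar>) \<longlonglongrightarrow> (LINT x|M. 0)"
  proof (rule integral_dominated_convergence)
    show "AE x in M. (\<lambda>n. \<bar>q x - f n x\<bar>) \<longlonglongrightarrow> 0"
      using lim by eventually_elim (auto intro!: tendsto_eq_intros)
    show "AE x in M. norm \<bar>q x - f n x\<bar> \<le> 1" for n
      using L1_01_bounds[OF f[of n]] q_bounds by eventually_elim auto
  qed auto
  hence L1: "(\<lambda>n. L1_norm \<Omega> (\<lambda>x. q x - f n x)) \<longlonglongrightarrow> 0"
    by (simp add: L1_norm_def)
  have "(\<lambda>n. LINT x|M. bernoulli_kl (f n x) (\<rho> x)) \<longlonglongrightarrow> (LINT x|M. bernoulli_kl (q x) (\<rho> x))"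
  proof (rule integral_dominated_convergence)
    show "AE x in M. (\<lambda>n. bernoulli_kl (f n x) (\<rho> x)) \<longlonglongrightarrow> bernoulli_kl (q x) (\<rho> x)"
      using lim all_bounds q_bounds \<rho>_bounds
    proof eventually_elim
      case (elim x)
      thus ?case using e
        by (intro continuous_on_tendsto_compose[OF continuous_on_bernoulli_kl[of "\<rho> x"]]) auto
    qed
    show "AE x in M. norm (bernoulli_kl (f n x) (\<rho> x)) \<le> - ln e" for n
      by (rule bernoulli_kl_AE_bound[OF f])
  qed auto
  hence bregman: "(\<lambda>n. bregman_FD \<Omega> (f n) \<rho>) \<longlonglongrightarrow> bregman_FD \<Omega> q \<rho>"
    by (simp add: bregman_FD_eq)
  obtain K where K: "\<And>f. f \<in> L1 \<Omega> \<Longrightarrow> \<bar>A f\<bar> \<le> K * L1_norm \<Omega> f"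
    using A unfolding bounded_linear_L1_def by blast
  \<comment> \<open>Boundedness of \<open>A\<close>, applied to \<open>q - f n\<close>, turns
    convergence in \<open>L1_norm\<close> into convergence of the values.\<close>
  have "(\<lambda>n. A q - A (f n)) \<longlonglongrightarrow> 0"
  proof (rule Lim_null_comparison)
    show "(\<lambda>n. K * L1_norm \<Omega> (\<lambda>x. q x - f n x)) \<longlonglongrightarrow> 0"
      using tendsto_mult_left[OF L1, of K] by simp
    have "norm (A q - A (f n)) \<le> K * L1_norm \<Omega> (\<lambda>x. q x - f n x)" for n
    proof -
      have int: "q \<in> L1 \<Omega>" "f n \<in> L1 \<Omega>" "(\<lambda>x. (-1) * f n x) \<in> L1 \<Omega>"
        using L1_01_integrable[OF q] L1_01_integrable[OF f] by (auto simp: L1_def)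
      have "A (\<lambda>x. q x - f n x) = A q - A (f n)"
        using A_add[OF int(1,3)] A_scale[OF int(2), of "-1"] by simp
      thus ?thesis using K[of "\<lambda>x. q x - f n x"] int by (simp add: L1_def)
    qed
    thus "\<forall>\<^sub>F n in sequentially. norm (A q - A (f n)) \<le> K * L1_norm \<Omega> (\<lambda>x. q x - f n x)"
      by simp
  qed
  hence "(\<lambda>n. A q - (A q - A (f n))) \<longlonglongrightarrow> A q - 0" by (intro tendsto_intros)
  hence "(\<lambda>n. A (f n)) \<longlonglongrightarrow> A q" by simp
  with bregman have "(\<lambda>n. J (f n)) \<longlonglongrightarrow> J q"
    unfolding J_FD_def by (intro tendsto_intros)
  with q L1 show thesis by (rule that)
qed

section \<open>Existence and uniqueness of the minimiser\<close>

theorem minimiser_exists_unique: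
  assumes "C \<noteq> {}" and C: "C \<subseteq> L1_01 \<Omega>" and closed: "closed_L1 \<Omega> C" and "convex_fun_set C"
  shows "\<exists>q. is_arg_min J (\<lambda>p. p \<in> C) q \<and>
    (\<forall>q'. is_arg_min J (\<lambda>p. p \<in> C) q' \<longrightarrow> (AE x in M. q' x = q x))"
proof -
  define m where "m = Inf (J ` C)"
  \<comment> \<open>The coefficient of the quadratic gain in \<open>J_midpoint\<close>.\<close>
  define c where "c = inverse \<alpha> / 8"
  have c: "0 < c" using \<alpha> by (simp add: c_def)
  have bdd: "bdd_below (J ` C)"
    using J_bounded_below C unfolding bdd_below_def by blast
  have m_le: "m \<le> J f" if "f \<in> C" for f
    unfolding m_def using that bdd by (intro cInf_lower) auto
  \<comment> \<open>By convexity the midpoint lies in \<open>C\<close>, so its value is at least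
    \<open>m\<close>; the gain is thus at most the mean excess of \<open>J f\<close> and
    \<open>J g\<close> over \<open>m\<close>.\<close>
  have gap: "c * (LINT x|M. (f x - g x)\<^sup>2) \<le> (J f + J g) / 2 - m" if "f \<in> C" "g \<in> C" for f g
  proof -
    let ?h = "\<lambda>x. 1/2 * f x + 1/2 * g x"
    have h: "?h \<in> C"
      using \<open>convex_fun_set C\<close>[unfolded convex_fun_set_def, rule_format, OF that, of "1/2" "1/2"]
      by simp
    have "f \<in> L1_01 \<Omega>" "g \<in> L1_01 \<Omega>" "?h \<in> L1_01 \<Omega>" using that h C by blast+
    from J_midpoint[OF this] m_le[OF h]
    have "m \<le> (J f + J g) / 2 - inverse \<alpha> * (LINT x|M. (f x - g x)\<^sup>2) / 8" by (rule order_trans[rotated])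
    moreover have "c * (LINT x|M. (f x - g x)\<^sup>2) = inverse \<alpha> * (LINT x|M. (f x - g x)\<^sup>2) / 8"
      by (simp add: c_def)
    ultimately show ?thesis by linarith
  qed
  \<comment> \<open>Chosen so that cancelling \<open>c\<close> in \<open>gap\<close> bounds the
    squared distance of consecutive terms by \<open>((1/2) ^ n)^2\<close>; with
    \<open>\<eta> = (1/2) ^ n\<close> the increments are then geometrically small.\<close>
  define \<delta> where "\<delta> n = c * ((1/2) ^ n)\<^sup>2" for n
  have \<delta>: "0 < \<delta> n" for n using c by (simp add: \<delta>_def)
  have \<delta>_Suc: "\<delta> (Suc n) \<le> \<delta> n" for n
    unfolding \<delta>_def using c by (intro mult_left_mono power_mono) auto
  have "\<exists>f\<in>C. J f < m + \<delta> n" for n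
    using cInf_lessD[of "J ` C" "m + \<delta> n"] \<open>C \<noteq> {}\<close> \<delta>[of n] by (auto simp: m_def)
  then obtain f where f: "\<And>n. f n \<in> C" and Jf: "\<And>n. J (f n) < m + \<delta> n"
    by metis
  have fL: "f n \<in> L1_01 \<Omega>" for n using f C by blast
  have increment: "(LINT x|M. \<bar>f n x - f (Suc n) x\<bar>) \<le> (1/2) ^ n * (1 + measure M (space M)) / 2"
    for n
  proof (rule integral_abs_le_of_integral_square)
    have "J (f (Suc n)) < m + \<delta> n" using Jf[of "Suc n"] \<delta>_Suc[of n] by simp
    with Jf[of n] have "(J (f n) + J (f (Suc n))) / 2 - m \<le> \<delta> n" by (simp add: field_simps)
    with gap[OF f f] have "c * (LINT x|M. (f n x - f (Suc n) x)\<^sup>2) \<le> \<delta> n"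
      by (rule order_trans)
    thus "(LINT x|M. (f n x - f (Suc n) x)\<^sup>2) \<le> ((1/2) ^ n)\<^sup>2"
      unfolding \<delta>_def using c by (rule mult_left_le_imp_le)
  qed (use L1_01_integrable[OF fL] square_diff_integrable[OF fL fL] in auto)
  have "summable (\<lambda>n. (1/2::real) ^ n * ((1 + measure M (space M)) / 2))"
    by (intro summable_mult2 summable_geometric) simp
  hence "summable (\<lambda>n. LINT x|M. \<bar>f n x - f (Suc n) x\<bar>)"
    by (rule summable_comparison_test[rotated]) (use increment in \<open>auto simp: field_simps\<close>)
  hence "AE x in M. convergent (\<lambda>n. f n x)"
    by (intro AE_convergent_if_summable_increments L1_01_integrable fL)
  then obtain q where q: "q \<in> L1_01 \<Omega>" "(\<lambda>n. L1_norm \<Omega> (\<lambda>x. q x - f n x)) \<longlonglongrightarrow> 0"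
    "(\<lambda>n. J (f n)) \<longlonglongrightarrow> J q"
    using AE_limit[of f] fL by blast
  \<comment> \<open>The terms \<open>f n\<close> exhibit \<open>q\<close> as an adherent point of
    \<open>C\<close>.\<close>
  have qC: "q \<in> C"
  proof -
    have "\<exists>g\<in>C. L1_norm \<Omega> (\<lambda>x. q x - g x) < \<epsilon>" if "0 < \<epsilon>" for \<epsilon>
    proof -
      have "\<forall>\<^sub>F n in sequentially. L1_norm \<Omega> (\<lambda>x. q x - f n x) < \<epsilon>"
        using q(2) that by (rule order_tendstoD)
      thus ?thesis using f by (auto simp: eventually_sequentially)
    qed
    moreover have "q \<in> L1 \<Omega>" using q(1) by (simp add: L1_01_def)
    ultimately show ?thesis using closed unfolding closed_L1_def by blast
  qed
  have "(\<lambda>n. m + \<delta> n) \<longlonglongrightarrow> m" unfolding \<delta>_def by real_asymp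
  hence "J q \<le> m"
    by (rule LIMSEQ_le[OF q(3)]) (use Jf in \<open>auto intro: less_imp_le\<close>)
  hence Jq: "J q = m" using m_le[OF qC] by simp
  have "AE x in M. q' x = q x" if "is_arg_min J (\<lambda>p. p \<in> C) q'" for q'
  proof -
    have q': "q' \<in> C" "J q' \<le> m"
      using that qC Jq by (auto simp: is_arg_min_def not_less)
    have int: "integrable M (\<lambda>x. (q' x - q x)\<^sup>2)"
      using square_diff_integrable q'(1) qC C by blast
    \<comment> \<open>Both values are at most \<open>m\<close>, so \<open>gap\<close> leaves no room
      for a positive distance.\<close>
    have "c * (LINT x|M. (q' x - q x)\<^sup>2) \<le> 0"
      using gap[OF q'(1) qC] q'(2) Jq by simp
    hence "(LINT x|M. (q' x - q x)\<^sup>2) \<le> 0" using c by (simp add: mult_le_0_iff)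
    moreover have "0 \<le> (LINT x|M. (q' x - q x)\<^sup>2)" by simp
    ultimately have "AE x in M. (q' x - q x)\<^sup>2 = 0"
      using integral_nonneg_eq_0_iff_AE[OF int] by simp
    thus ?thesis by simp
  qed
  moreover have "is_arg_min J (\<lambda>p. p \<in> C) q"
    using qC Jq m_le by (auto simp: is_arg_min_def not_less)
  ultimately show ?thesis by blast
qed

end

section \<open>Application to a bounded open domain\<close>

theorem lemma3p3:
  fixes \<Omega> :: "(real ^ 'd) set"
    and A :: "(real ^ 'd \<Rightarrow> real) \<Rightarrow> real"
    and \<alpha> :: real
    and \<rho> :: "real ^ 'd \<Rightarrow> real"
    and C :: "(real ^ 'd \<Rightarrow> real) set"
  assumes "CARD('d) = 2 \<or> CARD('d) = 3"
    and "open \<Omega>" and "connected \<Omega>" and "\<Omega> \<noteq> {}" and "bounded \<Omega>"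
    and "lipschitz_boundary \<Omega>"
    and "bounded_linear_L1 \<Omega> A"
    and "\<alpha> > 0"
    and "\<rho> \<in> int_Linfty_01 \<Omega>"
    and "C \<noteq> {}" and "C \<subseteq> L1_01 \<Omega>" and "closed_L1 \<Omega> C" and "convex_fun_set C"
  shows "\<exists>q. is_arg_min (J_FD \<Omega> A \<alpha> \<rho>) (\<lambda>p. p \<in> C) q \<and>
    (\<forall>q'. is_arg_min (J_FD \<Omega> A \<alpha> \<rho>) (\<lambda>p. p \<in> C) q' \<longrightarrow>
      (AE x in lebesgue_on \<Omega>. q' x = q x))"
proof -
  have "\<Omega> \<in> lmeasurable"
    using \<open>open \<Omega>\<close> \<open>bounded \<Omega>\<close> by (simp add: bounded_set_imp_lmeasurable)
  hence "finite_measure (lebesgue_on \<Omega>)" by (rule finite_measure_lebesgue_on)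
  moreover have "\<rho> \<in> borel_measurable (lebesgue_on \<Omega>)"
    using \<open>\<rho> \<in> int_Linfty_01 \<Omega>\<close> by (simp add: int_Linfty_01_def Linfty_def)
  moreover obtain e where "0 < e" "AE x in lebesgue_on \<Omega>. e \<le> \<rho> x \<and> \<rho> x \<le> 1 - e"
    using int_Linfty_01_bounds[OF \<open>\<rho> \<in> int_Linfty_01 \<Omega>\<close>] by blast
  ultimately interpret fd_problem \<Omega> A \<alpha> e \<rho>
    using \<open>bounded_linear_L1 \<Omega> A\<close> \<open>\<alpha> > 0\<close> by (intro fd_problem.intro)
  show ?thesis
    using \<open>C \<noteq> {}\<close> \<open>C \<subseteq> L1_01 \<Omega>\<close> \<open>closed_L1 \<Omega> C\<close> \<open>convex_fun_set C\<close>
    by (rule minimiser_exists_unique)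
qed

end
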